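(* Let $\{\boldsymbol P_k^{(\kappa)}\}_{k=1}^K$, $\{\boldsymbol U_k^{(\kappa)}\}_{k=1}^{K}$, $\kappa=0,1,2,\dots$, be the iterates generated by the ZFWS (zero-forcing wiretapped signal) interference alignment algorithm described in the context, for arbitrary channel matrices. Then the algorithm converges monotonically: the cost values $\mathfrak J^{(\kappa)}=\mathfrak J(\{\boldsymbol P_k^{(\kappa)}\}_{k=1}^K,\{\boldsymbol U_k^{(\kappa)}\}_{k=1}^{K})$ satisfy $\mathfrak J^{(\kappa+1)}\le\mathfrak J^{(\kappa)}$ for all $\kappa\ge0$, and the sequence $(\mathfrak J^{(\kappa)})_{\kappa\ge0}$ converges.
   Context: Let $K,M,N,N_e,d$ be positive integers with $d\le N$ and $M-N_e\ge d$, let $P_t>0$, and $\mathcal K=\{1,\dots,K\}$. There are $K$ transmitter-receiver pairs ($M$ transmit and $N$ receive antennas, $d$ data streams per pair) and an eavesdropper, indexed $K+1$, with $N_e$ antennas. The channel matrices are $\boldsymbol H_{k,\ell}\in\mathbb C^{N\times M}$ for $k,\ell\in\mathcal K$ and $\boldsymbol H_{K+1,\ell}\in\mathbb C^{N_e\times M}$ for $\ell\in\mathcal K$; they are fixed throughout the algorithm. For each $\ell\in\mathcal K$ take a (full) singular value decomposition $\boldsymbol H_{K+1,\ell}=\boldsymbol\Phi_\ell\boldsymbol\Sigma_\ell\boldsymbol\Xi_\ell^H$ with singular values in decreasing order and $\boldsymbol\Xi_\ell\in\mathbb C^{M\times M}$ unitary, and let $\boldsymbol\Delta_\ell\in\mathbb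 C^{M\times d}$ consist of the last $d$ columns of $\boldsymbol\Xi_\ell$ (so $\boldsymbol H_{K+1,\ell}\boldsymbol\Delta_\ell=\boldsymbol 0$). The precoder of transmitter $\ell$ is $\boldsymbol F_\ell=\boldsymbol\Delta_\ell\boldsymbol P_\ell$ with $\boldsymbol P_\ell\in\mathbb C^{d\times d}$, $\boldsymbol P_\ell^H\boldsymbol P_\ell=\frac{P_t}{d}\boldsymbol I_d$. The other variables are $\boldsymbol U_k\in\mathbb C^{N\times(N-d)}$ with $\boldsymbol U_k^H\boldsymbol U_k=\boldsymbol I$, $k\in\mathcal K$ (if $N=d$, $\boldsymbol U_k\boldsymbol U_k^H$ is read as $\boldsymbol 0$). Cost function (total interference leakage), with $\|\cdot\|_F$ the Frobenius norm: $$\mathfrak J(\{\boldsymbol P_k\}_{k=1}^K,\{\boldsymbol U_k\}_{k=1}^K)=\sum_{k\in\mathcal K}\sum_{\ell\in\mathcal K\setminus\{k\}}\|\boldsymbol H_{k,\ell}\boldsymbol\Delta_\ell\boldsymbol P_\ell-\boldsymbol U_k\boldsymbol U_k^H\boldsymbol H_{k,\ell}\boldsymbol\Delta_\ell\boldsymbol P_\ell\|_F^2 .$$ For a Hermitian matrix $\boldsymbol X$, $\zeta_{\min}^{r}\{\boldsymbol X\}$ (resp. $\zeta_{\max}^{r}\{\boldsymbol X\}$) denotes a matrix whose columns are $r$ orthonormal eigenvectors of $\boldsymbol X$ corresponding to its $r$ smallest (resp. $r$ largest) eigenvalues, counted with multiplicity; ties are broken arbitrarily. ZFWS algorithm (run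 without an iteration cap). $\boldsymbol P$-update, given $\{\boldsymbol U_k\}_{k=1}^K$: for every $\ell\in\mathcal K$, $$\boldsymbol P_\ell=\sqrt{\tfrac{P_t}{d}}\;\zeta_{\min}^d\Big\{\sum_{k\in\mathcal K\setminus\{\ell\}}\boldsymbol\Delta_\ell^H\boldsymbol H_{k,\ell}^H(\boldsymbol I-\boldsymbol U_k\boldsymbol U_k^H)\boldsymbol H_{k,\ell}\boldsymbol\Delta_\ell\Big\}.$$ $\boldsymbol U$-update, given $\{\boldsymbol P_\ell\}_{\ell=1}^K$: for every $k\in\mathcal K$, $$\boldsymbol U_k=\zeta_{\max}^{N-d}\Big\{\sum_{\ell\in\mathcal K\setminus\{k\}}\boldsymbol H_{k,\ell}\boldsymbol\Delta_\ell\boldsymbol P_\ell\boldsymbol P_\ell^H\boldsymbol\Delta_\ell^H\boldsymbol H_{k,\ell}^H\Big\}.$$ Initialization: $\boldsymbol U_k^{(0)}$ is the $N\times(N-d)$ matrix formed by the first $N-d$ columns of $\boldsymbol I_N$, $k\in\mathcal K$, and $\{\boldsymbol P_k^{(0)}\}$ is obtained from the $\boldsymbol P$-update with $\{\boldsymbol U_k^{(0)}\}$. Iteration $\kappa\to\kappa+1$: obtain $\{\boldsymbol U_k^{(\kappa+1)}\}$ from the $\boldsymbol U$-update with $\{\boldsymbol P_k^{(\kappa)}\}$, then $\{\boldsymbol P_k^{(\kappa+1)}\}$ from the $\boldsymbol P$-update with $\{\boldsymbol U_k^{(\kappa+1)}\}$. *)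

theory Defs
  imports Complex_Main "Jordan_Normal_Form.Schur_Decomposition"
begin

definition unitary_mat :: "nat \<Rightarrow> complex mat \<Rightarrow> bool" where
  "unitary_mat n Q \<longleftrightarrow> Q \<in> carrier_mat n n \<and>
     mat_adjoint Q * Q = 1\<^sub>m n \<and> Q * mat_adjoint Q = 1\<^sub>m n"

definition frobenius_norm :: "complex mat \<Rightarrow> real" where
  "frobenius_norm A = sqrt (\<Sum>i<dim_row A. \<Sum>j<dim_col A. (cmod (A $$ (i, j)))\<^sup>2)"

(* Unlike finite sums in a type class, a sum of matrices needs explicit dimensions:
   they determine the value of the empty sum. *)
definition mat_sum :: "nat \<Rightarrow> nat \<Rightarrow> ('i \<Rightarrow> complex mat) \<Rightarrow> 'i set \<Rightarrow> complex mat" where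
  "mat_sum nr nc A I = mat nr nc (\<lambda>(i, j). \<Sum>x\<in>I. A x $$ (i, j))"

definition first_cols :: "nat \<Rightarrow> complex mat \<Rightarrow> complex mat" where
  "first_cols r A = mat (dim_row A) r (\<lambda>(i, j). A $$ (i, j))"

definition last_cols :: "nat \<Rightarrow> complex mat \<Rightarrow> complex mat" where
  "last_cols r A = mat (dim_row A) r (\<lambda>(i, j). A $$ (i, dim_col A - r + j))"

(* Full singular value decomposition: S is rectangular, with the real nonnegative singular
   values in decreasing order on its main diagonal. *)
definition is_svd :: "complex mat \<Rightarrow> complex mat \<Rightarrow> complex mat \<Rightarrow> complex mat \<Rightarrow> bool" where
  "is_svd A Phi S Xi \<longleftrightarrow>
     unitary_mat (dim_row A) Phi \<and> unitary_mat (dim_col A) Xi \<and>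
     (\<exists>s :: nat \<Rightarrow> real.
        (\<forall>i < min (dim_row A) (dim_col A). 0 \<le> s i) \<and>
        (\<forall>i j. i \<le> j \<and> j < min (dim_row A) (dim_col A) \<longrightarrow> s j \<le> s i) \<and>
        S = mat (dim_row A) (dim_col A)
              (\<lambda>(i, j). if i = j then complex_of_real (s i) else 0)) \<and>
     A = Phi * S * mat_adjoint Xi"

(* The eigenvalues of a Hermitian matrix are real; as roots of the characteristic polynomial
   they are listed with multiplicity. *)
definition sorted_eigenvalues :: "complex mat \<Rightarrow> real list \<Rightarrow> bool" where
  "sorted_eigenvalues X es \<longleftrightarrow>
     sorted es \<and> char_poly X = (\<Prod>e\<leftarrow>es. [:- complex_of_real e, 1:])"

(* The columns of V are orthonormal eigenvectors of X for the eigenvalues es, in any order. *)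
definition orthonormal_eigenvectors :: "complex mat \<Rightarrow> real list \<Rightarrow> complex mat \<Rightarrow> bool" where
  "orthonormal_eigenvectors X es V \<longleftrightarrow>
     V \<in> carrier_mat (dim_row X) (length es) \<and>
     mat_adjoint V * V = 1\<^sub>m (length es) \<and>
     (\<exists>es'. mset es' = mset es \<and>
        (\<forall>j < length es. eigenvector X (col V j) (complex_of_real (es' ! j))))"

(* Relations rather than functions: every choice of eigenvectors is admitted, which covers
   all ways of breaking ties. *)
definition zeta_min :: "nat \<Rightarrow> complex mat \<Rightarrow> complex mat \<Rightarrow> bool" where
  "zeta_min r X V \<longleftrightarrow>
     (\<exists>es. sorted_eigenvalues X es \<and> r \<le> length es \<and>
        orthonormal_eigenvectors X (take r es) V)"

definition zeta_max :: "nat \<Rightarrow> complex mat \<Rightarrow> complex mat \<Rightarrow> bool" where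
  "zeta_max r X V \<longleftrightarrow>
     (\<exists>es. sorted_eigenvalues X es \<and> r \<le> length es \<and>
        orthonormal_eigenvectors X (take r (rev es)) V)"

(* For N = d the matrices U k have no columns, and U k * mat_adjoint (U k) is the zero matrix. *)
definition leakage_cost ::
  "nat \<Rightarrow> (nat \<Rightarrow> nat \<Rightarrow> complex mat) \<Rightarrow> (nat \<Rightarrow> complex mat) \<Rightarrow>
   (nat \<Rightarrow> complex mat) \<Rightarrow> (nat \<Rightarrow> complex mat) \<Rightarrow> real" where
  "leakage_cost K H Delta P U =
     (\<Sum>k\<in>{1..K}. \<Sum>l\<in>{1..K} - {k}.
        (frobenius_norm (H k l * Delta l * P l
           - U k * mat_adjoint (U k) * H k l * Delta l * P l))\<^sup>2)"

definition P_update ::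
  "nat \<Rightarrow> nat \<Rightarrow> nat \<Rightarrow> real \<Rightarrow> (nat \<Rightarrow> nat \<Rightarrow> complex mat) \<Rightarrow> (nat \<Rightarrow> complex mat) \<Rightarrow>
   (nat \<Rightarrow> complex mat) \<Rightarrow> (nat \<Rightarrow> complex mat) \<Rightarrow> bool" where
  "P_update K N d Pt H Delta U P \<longleftrightarrow>
     (\<forall>l\<in>{1..K}. \<exists>V.
        zeta_min d
          (mat_sum d d
             (\<lambda>k. mat_adjoint (Delta l) * mat_adjoint (H k l)
                    * (1\<^sub>m N - U k * mat_adjoint (U k)) * H k l * Delta l)
             ({1..K} - {l})) V \<and>
        P l = complex_of_real (sqrt (Pt / real d)) \<cdot>\<^sub>m V)"

definition U_update ::
  "nat \<Rightarrow> nat \<Rightarrow> nat \<Rightarrow> (nat \<Rightarrow> nat \<Rightarrow> complex mat) \<Rightarrow> (nat \<Rightarrow> complex mat) \<Rightarrow>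
   (nat \<Rightarrow> complex mat) \<Rightarrow> (nat \<Rightarrow> complex mat) \<Rightarrow> bool" where
  "U_update K N d H Delta P U \<longleftrightarrow>
     (\<forall>k\<in>{1..K}.
        zeta_max (N - d)
          (mat_sum N N
             (\<lambda>l. H k l * Delta l * P l * mat_adjoint (P l)
                    * mat_adjoint (Delta l) * mat_adjoint (H k l))
             ({1..K} - {k})) (U k))"

definition zfws_iterates ::
  "nat \<Rightarrow> nat \<Rightarrow> nat \<Rightarrow> real \<Rightarrow> (nat \<Rightarrow> nat \<Rightarrow> complex mat) \<Rightarrow> (nat \<Rightarrow> complex mat) \<Rightarrow>
   (nat \<Rightarrow> nat \<Rightarrow> complex mat) \<Rightarrow> (nat \<Rightarrow> nat \<Rightarrow> complex mat) \<Rightarrow> bool" where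
  "zfws_iterates K N d Pt H Delta P U \<longleftrightarrow>
     (\<forall>k\<in>{1..K}. U 0 k = first_cols (N - d) (1\<^sub>m N)) \<and>
     P_update K N d Pt H Delta (U 0) (P 0) \<and>
     (\<forall>\<kappa>. U_update K N d H Delta (P \<kappa>) (U (\<kappa> + 1)) \<and>
           P_update K N d Pt H Delta (U (\<kappa> + 1)) (P (\<kappa> + 1)))"

end

theory Submission
  imports Defs
begin

text \<open>The precoders produced by the \<open>P\<close>-update are square, so orthonormality of their columns makes
  them scaled unitary matrices and the cost does not depend on them. Only the \<open>U\<close>-update changes
  the cost: for fixed \<open>P\<close> and each \<open>k\<close>, with \<open>A l = H k l * Delta l * P l\<close>, the leakage equals
  the constant \<open>\<Sum>l. (frobenius_norm (A l))\<^sup>2\<close> minus the trace of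
  \<open>(U k)\<^sup>H (\<Sum>l. A l (A l)\<^sup>H) (U k)\<close>, and by Ky Fan's principle this trace is maximised, among all
  \<open>U k\<close> with orthonormal columns, by eigenvectors for the largest eigenvalues.\<close>

section \<open>Adjoints and entries of matrix products\<close>

lemma mat_adjoint_dim [simp]:
  "dim_row (mat_adjoint A) = dim_col A" "dim_col (mat_adjoint A) = dim_row A"
  by (simp_all add: mat_adjoint_def)

lemma mat_adjoint_carrier [simp, intro]:
  "A \<in> carrier_mat m n \<Longrightarrow> mat_adjoint A \<in> carrier_mat n m"
  by (intro carrier_matI) auto

lemma mat_adjoint_index [simp]:
  fixes A :: "complex mat"
  assumes "i < dim_col A" "j < dim_row A"
  shows "mat_adjoint A $$ (i, j) = cnj (A $$ (j, i))"
  using assms by (simp add: mat_adjoint_def mat_of_rows_def)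

lemma mat_adjoint_adjoint [simp]:
  fixes A :: "complex mat"
  shows "mat_adjoint (mat_adjoint A) = A"
  by (rule eq_matI) auto

lemma mat_mult_index:
  assumes "A \<in> carrier_mat m n" "B \<in> carrier_mat n p" "i < m" "j < p"
  shows "(A * B) $$ (i, j) = (\<Sum>k<n. A $$ (i, k) * B $$ (k, j))"
  using assms by (auto simp: scalar_prod_def atLeast0LessThan intro!: sum.cong)

text \<open>Exposes the vector \<open>B *\<^sub>v col C j\<close> inside an entry of a triple
  product, so that an eigenvector equation for a column of \<open>C\<close> can be substituted
  there.\<close>

lemma mat_mult_index_vec:
  assumes A: "A \<in> carrier_mat m n" and B: "B \<in> carrier_mat n p" and C: "C \<in> carrier_mat p q"
    and "i < m" "j < q"
  shows "(A * (B * C)) $$ (i, j) = row A i \<bullet> (B *\<^sub>v col C j)"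
proof -
  have "(A * (B * C)) $$ (i, j) = row A i \<bullet> col (B * C) j"
    using assms by (intro index_mult_mat(1)) auto
  then show ?thesis using col_mult2[OF B C \<open>j < q\<close>] by (simp only:)
qed

text \<open>Side conditions are stated as equalities of dimensions: all their variables occur in the
  left-hand side, so the rule serves the simplifier for regrouping long products to the
  right.\<close>

lemma mat_mult_assoc:
  "dim_col A = dim_row B \<Longrightarrow> dim_col B = dim_row C \<Longrightarrow> (A * B) * C = A * (B * C)"
  by (rule assoc_mult_mat) auto

lemma mat_adjoint_mult:
  fixes A B :: "complex mat"
  assumes A: "A \<in> carrier_mat m n" and B: "B \<in> carrier_mat n p"
  shows "mat_adjoint (A * B) = mat_adjoint B * mat_adjoint A"
proof (rule eq_matI)
  fix i j assume "i < dim_row (mat_adjoint B * mat_adjoint A)"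
    "j < dim_col (mat_adjoint B * mat_adjoint A)"
  then have i: "i < p" and j: "j < m" using A B by auto
  have "mat_adjoint (A * B) $$ (i, j) = cnj ((A * B) $$ (j, i))"
    using i j A B by (intro mat_adjoint_index) auto
  also have "\<dots> = (\<Sum>k<n. cnj (A $$ (j, k)) * cnj (B $$ (k, i)))"
    using i j by (simp add: mat_mult_index[OF A B])
  also have "\<dots> = (mat_adjoint B * mat_adjoint A) $$ (i, j)"
    using i j A B
    by (subst mat_mult_index[of _ p n _ m]) (auto intro!: sum.cong)
  finally show "mat_adjoint (A * B) $$ (i, j) = (mat_adjoint B * mat_adjoint A) $$ (i, j)" .
qed (use A B in auto)

lemma mat_adjoint_minus:
  fixes A B :: "complex mat"
  assumes "A \<in> carrier_mat m n" "B \<in> carrier_mat m n"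
  shows "mat_adjoint (A - B) = mat_adjoint A - mat_adjoint B"
  using assms by (intro eq_matI) auto

section \<open>Trace, Frobenius norm and finite sums of matrices\<close>

definition mat_trace :: "complex mat \<Rightarrow> complex" where
  "mat_trace A = (\<Sum>i<dim_row A. A $$ (i, i))"

lemma mat_trace_comm:
  assumes A: "A \<in> carrier_mat m n" and B: "B \<in> carrier_mat n m"
  shows "mat_trace (A * B) = mat_trace (B * A)"
proof -
  have "mat_trace (A * B) = (\<Sum>i<m. \<Sum>j<n. A $$ (i, j) * B $$ (j, i))"
    unfolding mat_trace_def using A by (auto intro!: sum.cong simp: mat_mult_index[OF A B])
  also have "\<dots> = (\<Sum>j<n. \<Sum>i<m. B $$ (j, i) * A $$ (i, j))"
    by (subst sum.swap) (simp add: mult.commute)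
  also have "\<dots> = mat_trace (B * A)"
    unfolding mat_trace_def using B by (auto intro!: sum.cong simp: mat_mult_index[OF B A])
  finally show ?thesis .
qed

text \<open>A difference takes its dimensions from the second matrix, so it is the diagonal of
  \<open>B\<close> that has to lie within range.\<close>

lemma mat_trace_minus:
  assumes "dim_row A = dim_row B" "dim_row B \<le> dim_col B"
  shows "mat_trace (A - B) = mat_trace A - mat_trace B"
  using assms by (auto simp: mat_trace_def sum_subtractf)

lemma mat_trace_smult: "A \<in> carrier_mat n n \<Longrightarrow> mat_trace (c \<cdot>\<^sub>m A) = c * mat_trace A"
  by (auto simp: mat_trace_def sum_distrib_left)

text \<open>Turns squared norms into traces, where cyclicity is available.\<close>

lemma frobenius_norm_sq: "(frobenius_norm A)\<^sup>2 = Re (mat_trace (mat_adjoint A * A))"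
proof -
  have "(frobenius_norm A)\<^sup>2 = (\<Sum>i<dim_row A. \<Sum>j<dim_col A. (cmod (A $$ (i, j)))\<^sup>2)"
    unfolding frobenius_norm_def by (intro real_sqrt_pow2 sum_nonneg) auto
  also have "\<dots> = (\<Sum>j<dim_col A. \<Sum>i<dim_row A. (cmod (A $$ (i, j)))\<^sup>2)"
    by (rule sum.swap)
  also have "complex_of_real \<dots> = mat_trace (mat_adjoint A * A)"
    unfolding mat_trace_def of_real_sum
    by (auto intro!: sum.cong simp: mat_mult_index[of _ "dim_col A" "dim_row A" _ "dim_col A"]
        complex_norm_square mult.commute simp flip: of_real_power simp del: index_mult_mat(1))
  finally show ?thesis by (metis Re_complex_of_real)
qed

lemma mat_sum_index:
  "i < m \<Longrightarrow> j < n \<Longrightarrow> mat_sum m n A I $$ (i, j) = (\<Sum>x\<in>I. A x $$ (i, j))"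
  by (simp add: mat_sum_def)

lemma mat_sum_carrier [simp]: "mat_sum m n A I \<in> carrier_mat m n"
  by (simp add: mat_sum_def)

lemma mat_sum_dim [simp]: "dim_row (mat_sum m n A I) = m" "dim_col (mat_sum m n A I) = n"
  by (simp_all add: mat_sum_def)

lemma mat_sum_cong:
  "(\<And>x. x \<in> I \<Longrightarrow> A x = B x) \<Longrightarrow> mat_sum m n A I = mat_sum m n B I"
  by (auto simp: mat_sum_def intro!: eq_matI)

lemma mat_adjoint_sum_self:
  assumes "\<And>x. x \<in> I \<Longrightarrow> A x \<in> carrier_mat n n" "\<And>x. x \<in> I \<Longrightarrow> mat_adjoint (A x) = A x"
  shows "mat_adjoint (mat_sum n n A I) = mat_sum n n A I"
proof (rule eq_matI)
  fix i j assume ij: "i < dim_row (mat_sum n n A I)" "j < dim_col (mat_sum n n A I)"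
  have "cnj (A x $$ (j, i)) = A x $$ (i, j)" if "x \<in> I" for x
  proof -
    have "cnj (A x $$ (j, i)) = mat_adjoint (A x) $$ (i, j)"
      using assms(1)[OF that] ij by (subst mat_adjoint_index) auto
    then show ?thesis using assms(2)[OF that] by simp
  qed
  then show "mat_adjoint (mat_sum n n A I) $$ (i, j) = mat_sum n n A I $$ (i, j)"
    using ij by (simp add: mat_sum_index)
qed auto

lemma mat_trace_mult_sum:
  assumes "finite I" "\<And>x. x \<in> I \<Longrightarrow> A x \<in> carrier_mat n n" and C: "C \<in> carrier_mat n n"
  shows "mat_trace (C * mat_sum n n A I) = (\<Sum>x\<in>I. mat_trace (C * A x))"
proof -
  have "mat_trace (C * A x) = (\<Sum>i<n. \<Sum>k<n. C $$ (i, k) * A x $$ (k, i))" if "x \<in> I" for x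
    unfolding mat_trace_def using C
    by (auto intro!: sum.cong simp: mat_mult_index[OF C assms(2)[OF that]])
  moreover have "mat_trace (C * mat_sum n n A I)
      = (\<Sum>i<n. \<Sum>k<n. \<Sum>x\<in>I. C $$ (i, k) * A x $$ (k, i))"
    unfolding mat_trace_def using C
    by (auto intro!: sum.cong
        simp: mat_mult_index[OF C mat_sum_carrier] mat_sum_index sum_distrib_left
        simp del: index_mult_mat(1))
  moreover have "(\<Sum>x\<in>I. \<Sum>i<n. \<Sum>k<n. C $$ (i, k) * A x $$ (k, i))
      = (\<Sum>i<n. \<Sum>k<n. \<Sum>x\<in>I. C $$ (i, k) * A x $$ (k, i))"
    by (subst sum.swap, subst sum.swap[of _ I]) (rule refl)
  ultimately show ?thesis by simp
qed

text \<open>Cyclicity of the trace moves \<open>W\<close> next to its adjoint; what remains is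
  linear in the other factor.\<close>

lemma mat_trace_conj_sum:
  assumes I: "finite I" "\<And>x. x \<in> I \<Longrightarrow> A x \<in> carrier_mat n n" and W: "W \<in> carrier_mat n r"
  shows "mat_trace (mat_adjoint W * mat_sum n n A I * W)
    = (\<Sum>x\<in>I. mat_trace (mat_adjoint W * A x * W))"
proof -
  have *: "mat_trace (mat_adjoint W * B * W) = mat_trace ((W * mat_adjoint W) * B)"
    if B: "B \<in> carrier_mat n n" for B
    using W B mat_trace_comm[of "mat_adjoint W * B" r n W]
    by (simp add: mat_mult_assoc mult_carrier_mat[of _ r n _ n])
  have "mat_trace (mat_adjoint W * mat_sum n n A I * W)
      = (\<Sum>x\<in>I. mat_trace ((W * mat_adjoint W) * A x))"
    using I W by (simp add: * mat_trace_mult_sum mult_carrier_mat[of W n r])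
  then show ?thesis using I(2) * by simp
qed

section \<open>Frobenius norms under projections and scaled unitary factors\<close>

text \<open>Pythagoras for the orthogonal projection \<open>U * mat_adjoint U\<close>. With
  \<open>B = mat_adjoint U * A\<close>, both cross terms and the quadratic term in the expansion of
  \<open>mat_adjoint (A - U * B) * (A - U * B)\<close> reduce to \<open>mat_adjoint B * B\<close>,
  so one copy survives with a minus sign. Cyclicity turns its trace into the one stated.\<close>

lemma orthonormal_residual_frobenius:
  assumes A: "A \<in> carrier_mat n m" and U: "U \<in> carrier_mat n r"
    and UU: "mat_adjoint U * U = 1\<^sub>m r"
  shows "(frobenius_norm (A - U * mat_adjoint U * A))\<^sup>2
    = (frobenius_norm A)\<^sup>2 - Re (mat_trace (mat_adjoint U * (A * mat_adjoint A) * U))"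
proof -
  define B where "B = mat_adjoint U * A"
  have B: "B \<in> carrier_mat r m" unfolding B_def using A U by auto
  have UB: "U * B \<in> carrier_mat n m" using U B by auto
  have UA: "U * mat_adjoint U * A = U * B"
    unfolding B_def using A U by (intro assoc_mult_mat) auto
  have Bh: "mat_adjoint B = mat_adjoint A * U"
    unfolding B_def using A U by (subst mat_adjoint_mult) auto
  have 1: "mat_adjoint (U * B) * A = mat_adjoint B * B"
    unfolding mat_adjoint_mult[OF U B] B_def[symmetric]
    using assoc_mult_mat[of "mat_adjoint B" m r "mat_adjoint U" n A m] A U B
    by (simp add: B_def)
  have 2: "mat_adjoint A * (U * B) = mat_adjoint B * B"
    using assoc_mult_mat[of "mat_adjoint A" m n U r B m] A U B by (simp add: Bh)
  have "mat_adjoint (U * B) * (U * B) = mat_adjoint B * (mat_adjoint U * (U * B))"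
    unfolding mat_adjoint_mult[OF U B]
    using U B by (intro assoc_mult_mat) auto
  also have "mat_adjoint U * (U * B) = B"
    using assoc_mult_mat[of "mat_adjoint U" r n U r B m] U B UU by simp
  finally have 3: "mat_adjoint (U * B) * (U * B) = mat_adjoint B * B" .
  have "mat_adjoint (A - U * B) * (A - U * B) =
      (mat_adjoint A - mat_adjoint (U * B)) * A - (mat_adjoint A - mat_adjoint (U * B)) * (U * B)"
    unfolding mat_adjoint_minus[OF A UB]
    using A UB by (intro mult_minus_distrib_mat[of _ m n]) (auto intro!: minus_carrier_mat)
  also have "\<dots> = mat_adjoint A * A - mat_adjoint B * B
      - (mat_adjoint B * B - mat_adjoint B * B)"
    using A UB minus_mult_distrib_mat[of "mat_adjoint A" m n "mat_adjoint (U * B)"]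
    by (simp add: 1 2 3)
  also have "mat_trace \<dots> = mat_trace (mat_adjoint A * A) - mat_trace (mat_adjoint B * B)"
    using A B by (simp add: mat_trace_minus)
  also have "mat_trace (mat_adjoint B * B) = mat_trace (B * mat_adjoint B)"
    using B by (intro mat_trace_comm[of _ m r]) auto
  also have "B * mat_adjoint B = mat_adjoint U * (A * mat_adjoint A) * U"
    unfolding Bh unfolding B_def using A U
    by (simp add: mat_mult_assoc)
  finally show ?thesis unfolding UA frobenius_norm_sq by simp
qed

text \<open>Cyclicity of the trace brings \<open>P\<close> next to its adjoint in the middle of the
  product, where \<open>P * mat_adjoint P\<close> collapses to a scalar.\<close>

lemma frobenius_norm_mult_scaled_unitary:
  assumes X: "X \<in> carrier_mat n d" and P: "P \<in> carrier_mat d d"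
    and PP: "P * mat_adjoint P = complex_of_real c \<cdot>\<^sub>m 1\<^sub>m d"
  shows "(frobenius_norm (X * P))\<^sup>2 = c * (frobenius_norm X)\<^sup>2"
proof -
  have XP: "X * P \<in> carrier_mat n d" using X P by auto
  have "mat_trace (mat_adjoint (X * P) * (X * P)) = mat_trace ((X * P) * mat_adjoint (X * P))"
    using XP by (intro mat_trace_comm[of _ d n]) auto
  also have "(X * P) * mat_adjoint (X * P) = X * ((P * mat_adjoint P) * mat_adjoint X)"
    unfolding mat_adjoint_mult[OF X P] using X P
    by (simp add: mat_mult_assoc)
  also have "\<dots> = complex_of_real c \<cdot>\<^sub>m (X * mat_adjoint X)"
    unfolding PP using X
    by (simp add: mult_smult_assoc_mat[of "1\<^sub>m d" d d "mat_adjoint X" n]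
        mult_smult_distrib[of X n d "mat_adjoint X" n] left_mult_one_mat[of _ d n])
  also have "mat_trace \<dots> = c * mat_trace (X * mat_adjoint X)"
    using X by (intro mat_trace_smult) auto
  also have "mat_trace (X * mat_adjoint X) = mat_trace (mat_adjoint X * X)"
    using X by (intro mat_trace_comm[of _ n d]) auto
  finally show ?thesis unfolding frobenius_norm_sq by simp
qed

section \<open>Spectral theorem for Hermitian matrices\<close>

text \<open>Complete \<open>v\<close> to a basis and apply Gram-Schmidt, which leaves the first
  vector unchanged. Normalising the resulting vectors makes the columns orthonormal and replaces
  \<open>v\<close> by a scalar multiple, still an eigenvector.\<close>

lemma eigenvector_extends_to_unitary:
  fixes A :: "complex mat"
  assumes A: "A \<in> carrier_mat n n" and v: "eigenvector A v e"
  obtains W where "W \<in> carrier_mat n n" "mat_adjoint W * W = 1\<^sub>m n"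
    "A *\<^sub>v col W 0 = e \<cdot>\<^sub>v col W 0"
proof -
  have vc: "v \<in> carrier_vec n" and v0: "v \<noteq> 0\<^sub>v n" and Av: "A *\<^sub>v v = e \<cdot>\<^sub>v v"
    using v A by (auto simp: eigenvector_def)
  have n: "0 < n"
    using vc v0 by (cases n) auto
  interpret cof_vec_space n "TYPE(complex)" .
  define b where "b = basis_completion v"
  have b: "distinct b" "\<not> lin_dep (set b)" "set b \<subseteq> carrier_vec n" "hd b = v" "length b = n"
    using basis_completion[OF vc v0, folded b_def] by auto
  then obtain vs where bv: "b = v # vs" using n by (cases b) auto
  define ws where "ws = gram_schmidt n b"
  have ws: "set ws \<subseteq> carrier_vec n" "corthogonal ws" "length ws = n"
    using gram_schmidt_result[OF b(3,1,2) refl, folded ws_def] b(5) by auto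
  have "hd ws = v"
    using gram_schmidt_hd[OF vc, of vs] by (simp add: ws_def bv)
  then have ws0: "ws ! 0 = v" using ws(3) n by (metis hd_conv_nth length_greater_0_conv)
  have wsc: "ws ! i \<in> carrier_vec n" if "i < n" for i
    using ws that by auto
  \<comment> \<open>Squared lengths: \<open>gram_schmidt\<close> yields orthogonal vectors that need
    not have norm one, so the columns of \<open>W\<close> below are divided by
    \<open>sqrt (s j)\<close>.\<close>
  define s where "s i = (\<Sum>k<n. (cmod (ws ! i $ k))\<^sup>2)" for i
  have cs: "ws ! i \<bullet>c ws ! j = (\<Sum>k<n. ws ! i $ k * cnj (ws ! j $ k))" if "i < n" "j < n" for i j
    using wsc[OF that(1)] wsc[OF that(2)]
    by (auto simp: scalar_prod_def atLeast0LessThan intro!: sum.cong)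
  have ss: "ws ! i \<bullet>c ws ! i = complex_of_real (s i)" if "i < n" for i
    by (simp only: cs[OF that that] s_def of_real_sum complex_norm_square)
  have spos: "s i > 0" if "i < n" for i
  proof -
    have "s i \<noteq> 0" using ss[OF that] corthogonalD[OF ws(2), of i i] ws(3) that by auto
    moreover have "s i \<ge> 0" by (auto simp: s_def intro: sum_nonneg)
    ultimately show ?thesis by simp
  qed
  define W where "W = mat n n (\<lambda>(i, j). ws ! j $ i / complex_of_real (sqrt (s j)))"
  have W: "W \<in> carrier_mat n n" by (simp add: W_def)
  have "mat_adjoint W * W = 1\<^sub>m n"
  proof (rule eq_matI)
    fix i j assume "i < dim_row (1\<^sub>m n :: complex mat)" "j < dim_col (1\<^sub>m n :: complex mat)"
    then have ij: "i < n" "j < n" by auto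
    have "(mat_adjoint W * W) $$ (i, j)
        = (\<Sum>k<n. (ws ! j $ k * cnj (ws ! i $ k)) / complex_of_real (sqrt (s i) * sqrt (s j)))"
      using ij W by (subst mat_mult_index[of _ n n _ n])
        (auto simp: W_def field_simps intro!: sum.cong)
    also have "\<dots> = (ws ! j \<bullet>c ws ! i) / complex_of_real (sqrt (s i) * sqrt (s j))"
      by (simp add: cs ij sum_divide_distrib)
    also have "\<dots> = (1\<^sub>m n) $$ (i, j)"
    proof (cases "i = j")
      case True
      then show ?thesis using ij spos[of j] by (simp add: ss flip: of_real_mult of_real_divide)
    next
      case False
      then show ?thesis using ij corthogonalD[OF ws(2), of j i] ws(3) by simp
    qed
    finally show "(mat_adjoint W * W) $$ (i, j) = (1\<^sub>m n) $$ (i, j)" .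
  qed (use W in auto)
  moreover have "col W 0 = (1 / complex_of_real (sqrt (s 0))) \<cdot>\<^sub>v v"
    using n vc by (intro eq_vecI) (auto simp: W_def ws0)
  then have "A *\<^sub>v col W 0 = e \<cdot>\<^sub>v col W 0"
    using A vc Av mult_mat_vec[OF A vc, of "1 / complex_of_real (sqrt (s 0))"]
    by (simp add: smult_smult_assoc mult.commute)
  ultimately show ?thesis using W that by blast
qed

text \<open>In an orthonormal basis starting with an eigenvector, the first column of the conjugated
  matrix is \<open>e\<close> followed by zeros. Conjugation preserves Hermitian symmetry, which
  clears the rest of the first row and makes the remaining block \<open>Y\<close> Hermitian.\<close>

lemma hermitian_deflate:
  fixes X :: "complex mat"
  assumes X: "X \<in> carrier_mat (Suc m) (Suc m)" and herm: "mat_adjoint X = X"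
    and ev: "eigenvector X v e"
  obtains W Y where "W \<in> carrier_mat (Suc m) (Suc m)" "mat_adjoint W * W = 1\<^sub>m (Suc m)"
    "Y \<in> carrier_mat m m" "mat_adjoint Y = Y"
    "mat_adjoint W * X * W
      = four_block_mat (mat 1 1 (\<lambda>_. e)) (0\<^sub>m 1 m) (0\<^sub>m m 1) Y"
proof -
  let ?n = "Suc m"
  obtain W where W: "W \<in> carrier_mat ?n ?n" and WW: "mat_adjoint W * W = 1\<^sub>m ?n"
    and Xw: "X *\<^sub>v col W 0 = e \<cdot>\<^sub>v col W 0"
    using eigenvector_extends_to_unitary[OF X ev] by metis
  define B where "B = mat_adjoint W * X * W"
  have B: "B \<in> carrier_mat ?n ?n" unfolding B_def using W X by auto
  have Bherm: "mat_adjoint B = B"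
    unfolding B_def using W X herm
    by (simp add: mat_adjoint_mult[of _ ?n ?n _ ?n] mult_carrier_mat[of _ ?n ?n] mat_mult_assoc)
  have B_sym: "B $$ (i, j) = cnj (B $$ (j, i))" if "i < ?n" "j < ?n" for i j
    using mat_adjoint_index[of i B j] that B Bherm by simp
  have B0: "B $$ (i, 0) = (if i = 0 then e else 0)" if i: "i < ?n" for i
  proof -
    have "B = mat_adjoint W * (X * W)" unfolding B_def using W X by (simp add: mat_mult_assoc)
    then have "B $$ (i, 0) = row (mat_adjoint W) i \<bullet> (X *\<^sub>v col W 0)"
      using W X i by (simp only:) (intro mat_mult_index_vec[of _ ?n ?n _ ?n _ ?n]; simp)
    also have "\<dots> = e * (row (mat_adjoint W) i \<bullet> col W 0)"
      unfolding Xw using W by (intro scalar_prod_smult_distrib[of _ ?n]) (auto intro!: carrier_vecI)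
    also have "row (mat_adjoint W) i \<bullet> col W 0 = (mat_adjoint W * W) $$ (i, 0)"
      using W i by simp
    finally show ?thesis using i by (simp add: WW)
  qed
  define Y where "Y = mat m m (\<lambda>(i, j). B $$ (Suc i, Suc j))"
  have "B = four_block_mat (mat 1 1 (\<lambda>_. e)) (0\<^sub>m 1 m) (0\<^sub>m m 1) Y" (is "_ = ?F")
  proof (rule eq_matI)
    fix i j assume "i < dim_row ?F" "j < dim_col ?F"
    then have ij: "i < ?n" "j < ?n" by (auto simp: Y_def)
    show "B $$ (i, j) = ?F $$ (i, j)"
    proof (cases "j = 0")
      case True
      then show ?thesis using ij B0[of i] by (auto simp: Y_def)
    next
      case False
      then show ?thesis using ij B0[of j] B_sym[of 0 j] by (cases "i = 0") (auto simp: Y_def)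
    qed
  qed (use B in \<open>auto simp: Y_def\<close>)
  moreover have "mat_adjoint Y = Y"
  proof (rule eq_matI)
    fix i j assume "i < dim_row Y" "j < dim_col Y"
    then show "mat_adjoint Y $$ (i, j) = Y $$ (i, j)"
      using B_sym[of "Suc i" "Suc j"] by (auto simp: Y_def)
  qed (auto simp: Y_def)
  moreover have "Y \<in> carrier_mat m m" by (simp add: Y_def)
  ultimately show ?thesis using that[OF W WW] by (simp add: B_def)
qed

text \<open>Induction on the list of roots rather than on the dimension, so that the diagonal
  carries the eigenvalues in the prescribed order; a sorted list thus gives a sorted diagonal. Each
  step splits off the head of the list by deflation and removes its linear factor from the
  characteristic polynomial.\<close>

lemma hermitian_diagonalization:
  fixes X :: "complex mat"
  assumes "X \<in> carrier_mat n n" "mat_adjoint X = X"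
    and "char_poly X = (\<Prod>e\<leftarrow>es. [:- e, 1:])"
  shows "\<exists>Q \<in> carrier_mat n n. mat_adjoint Q * Q = 1\<^sub>m n \<and>
    mat_adjoint Q * X * Q = mat n n (\<lambda>(i, j). if i = j then es ! i else 0)"
  using assms
proof (induction es arbitrary: n X)
  case Nil
  then have "n = 0" using degree_monic_char_poly[OF Nil(1)] by simp
  then show ?case using Nil(1) by (intro bexI[of _ "1\<^sub>m 0"]) (auto intro!: eq_matI)
next
  case (Cons e es)
  note X = Cons.prems(1)
  have "poly (char_poly X) e = 0" by (simp add: Cons.prems(3))
  then have ev: "eigenvalue X e" by (simp add: eigenvalue_root_char_poly[OF X])
  then obtain m where n: "n = Suc m"
    using eigenvalue_imp_nonzero_dim[OF X] gr0_conv_Suc by auto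
  obtain v where "eigenvector X v e" using ev by (auto simp: eigenvalue_def)
  then obtain W Y where W: "W \<in> carrier_mat n n" and WW: "mat_adjoint W * W = 1\<^sub>m n"
    and Y: "Y \<in> carrier_mat m m" and Yherm: "mat_adjoint Y = Y"
    and WXW: "mat_adjoint W * X * W
      = four_block_mat (mat 1 1 (\<lambda>_. e)) (0\<^sub>m 1 m) (0\<^sub>m m 1) Y" (is "_ = ?F")
    using hermitian_deflate[OF X[unfolded n] Cons.prems(2)] n by metis
  \<comment> \<open>A left inverse of a square matrix is also a right inverse; similarity needs
    both.\<close>
  have WW': "W * mat_adjoint W = 1\<^sub>m n"
    using mat_mult_left_right_inverse[OF _ W WW] W by auto
  have "similar_mat ?F X"
    using W X WW WW' Y n by (intro similar_matI[of _ _ "mat_adjoint W" W n]) (auto simp: WXW)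
  then have "char_poly X = char_poly ?F" by (simp add: char_poly_similar)
  also have "\<dots> = char_poly (mat 1 1 (\<lambda>_. e)) * char_poly Y"
    using Y by (intro char_poly_four_block_zeros_col) auto
  also have "char_poly (mat 1 1 (\<lambda>_. e)) = [:- e, 1:]"
    by (simp add: char_poly_defs det_def sign_def)
  finally have "[:- e, 1:] * char_poly Y = [:- e, 1:] * (\<Prod>e\<leftarrow>es. [:- e, 1:])"
    unfolding Cons.prems(3) by simp
  then have "char_poly Y = (\<Prod>e\<leftarrow>es. [:- e, 1:])"
    unfolding mult_cancel_left by simp
  from Cons.IH[OF Y Yherm this] obtain R where R: "R \<in> carrier_mat m m"
    and RR: "mat_adjoint R * R = 1\<^sub>m m"
    and RYR: "mat_adjoint R * Y * R = mat m m (\<lambda>(i, j). if i = j then es ! i else 0)" by auto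
  \<comment> \<open>\<open>G\<close> applies the diagonalising \<open>R\<close> of the smaller block
    and fixes the first basis vector, already an eigenvector. The required matrix is
    \<open>W * G\<close>.\<close>
  define G where "G = four_block_mat (1\<^sub>m 1) (0\<^sub>m 1 m) (0\<^sub>m m 1) R"
  have G: "G \<in> carrier_mat n n" unfolding G_def using R n by auto
  have Gh: "mat_adjoint G = four_block_mat (1\<^sub>m 1) (0\<^sub>m 1 m) (0\<^sub>m m 1) (mat_adjoint R)"
    unfolding G_def using R by (intro eq_matI) auto
  have GG: "mat_adjoint G * G = 1\<^sub>m n"
    unfolding Gh unfolding G_def using R RR n
    by (subst mult_four_block_mat[of _ 1 1 _ m _ m _ _ 1 _ m]) (auto intro!: eq_matI)
  have "mat_adjoint G * ?F * G
      = four_block_mat (mat 1 1 (\<lambda>_. e)) (0\<^sub>m 1 m) (0\<^sub>m m 1) (mat_adjoint R * Y * R)"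
    unfolding Gh unfolding G_def using R Y
    by (simp add: mult_four_block_mat[of _ 1 1 _ m _ m _ _ 1 _ m] mult_carrier_mat[of _ m m])
  also have "\<dots> = mat n n (\<lambda>(i, j). if i = j then (e # es) ! i else 0)"
    unfolding RYR n by (intro eq_matI) (auto simp: nth_Cons')
  finally have D: "mat_adjoint G * ?F * G = \<dots>" .
  have "mat_adjoint (W * G) * (W * G) = mat_adjoint G * (mat_adjoint W * W) * G"
    using W G by (simp add: mat_adjoint_mult[OF W G] mat_mult_assoc)
  also have "\<dots> = 1\<^sub>m n" using G GG by (simp add: WW)
  finally have 1: "mat_adjoint (W * G) * (W * G) = 1\<^sub>m n" .
  have 2: "mat_adjoint (W * G) * X * (W * G) = mat_adjoint G * (mat_adjoint W * X * W) * G"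
    using W G X by (simp add: mat_adjoint_mult[OF W G] mat_mult_assoc)
  show ?case using W G 1 2 D by (intro bexI[of _ "W * G"]) (auto simp: WXW)
qed

section \<open>Ky Fan's maximum principle\<close>

lemma sum_list_take_rev:
  fixes es :: "real list"
  assumes "r \<le> length es"
  shows "sum_list (take r (rev es)) = (\<Sum>i\<in>{length es - r..<length es}. es ! i)"
proof -
  have "take r (rev es) = rev (drop (length es - r) es)"
    using assms by (simp add: take_rev)
  then have "sum_list (take r (rev es)) = sum_list (drop (length es - r) es)"
    by simp
  also have "\<dots> = (\<Sum>i = 0..<r. es ! (length es - r + i))"
    using assms unfolding sum_list_sum_nth by (intro sum.cong) auto
  also have "\<dots> = (\<Sum>i\<in>{length es - r..<length es}. es ! i)"
    using assms sum.shift_bounds_nat_ivl[of "(!) es" 0 "length es - r" r] by (simp add: add.commute)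
  finally show ?thesis .
qed

text \<open>An exchange argument: among weights in [0, 1] of total \<open>r\<close>, putting weight
  1 on the last \<open>r\<close> positions is best. Moving weight from below the threshold
  \<open>c\<close> to above it never lowers the sum.\<close>

lemma sorted_weighted_sum_le_top:
  fixes es :: "real list" and t :: "nat \<Rightarrow> real"
  assumes sorted: "sorted es" and r: "r \<le> length es"
    and t: "\<And>i. i < length es \<Longrightarrow> 0 \<le> t i \<and> t i \<le> 1"
    and sum_t: "(\<Sum>i<length es. t i) = real r"
  shows "(\<Sum>i<length es. es ! i * t i) \<le> sum_list (take r (rev es))"
proof (cases "r = 0")
  case True
  then have "\<forall>i\<in>{..<length es}. t i = 0"
    using sum_t t sum_nonneg_eq_0_iff[of "{..<length es}" t] by auto
  then show ?thesis using True by simp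
next
  case False
  let ?n = "length es"
  \<comment> \<open>The \<open>r\<close>-th largest entry. Its index is in range because
    \<open>r\<close> is nonzero here, which is why the case \<open>r = 0\<close> is
    separate.\<close>
  define c where "c = es ! (?n - r)"
  define top where "top i = (if ?n - r \<le> i then 1 else 0 :: real)" for i
  have top_sum: "(\<Sum>i<?n. f i * top i) = (\<Sum>i\<in>{?n - r..<?n}. f i)" for f :: "nat \<Rightarrow> real"
    by (rule sum.mono_neutral_cong_right) (auto simp: top_def)
  \<comment> \<open>The two factors have opposite signs in every term: on the top positions
    \<open>es ! i\<close> is at least \<open>c\<close> and \<open>t i\<close> at most 1, while below
    them \<open>es ! i\<close> is at most \<open>c\<close> and \<open>t i\<close> at least
    0.\<close>
  have "(\<Sum>i<?n. (es ! i - c) * (t i - top i)) \<le> 0"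
  proof (rule sum_nonpos)
    fix i assume i: "i \<in> {..<?n}"
    show "(es ! i - c) * (t i - top i) \<le> 0"
    proof (cases "?n - r \<le> i")
      case True
      then have "c \<le> es ! i" using i sorted by (simp add: c_def sorted_nth_mono)
      then show ?thesis using True i t[of i] by (simp add: top_def mult_nonneg_nonpos)
    next
      case F: False
      then have "es ! i \<le> c" using False r sorted by (simp add: c_def sorted_nth_mono)
      then show ?thesis using F i t[of i] by (simp add: top_def mult_nonpos_nonneg)
    qed
  qed
  \<comment> \<open>Both weightings have total \<open>r\<close>, so the contribution of
    \<open>c\<close> cancels.\<close>
  moreover have "(\<Sum>i<?n. (es ! i - c) * (t i - top i))
      = (\<Sum>i<?n. es ! i * t i) - (\<Sum>i<?n. es ! i * top i)
        - c * ((\<Sum>i<?n. t i) - (\<Sum>i<?n. 1 * top i))"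
    by (simp add: algebra_simps sum.distrib sum_subtractf sum_distrib_left)
  moreover have "(\<Sum>i<?n. 1 * top i) = real r"
    using r by (simp only: top_sum) simp
  ultimately show ?thesis
    by (simp add: sum_t top_sum sum_list_take_rev[OF r])
qed

lemma orthonormal_cols_row_sum_le_one:
  fixes Y :: "complex mat"
  assumes Y: "Y \<in> carrier_mat n r" and YY: "mat_adjoint Y * Y = 1\<^sub>m r" and i: "i < n"
  shows "(\<Sum>j<r. (cmod (Y $$ (i, j)))\<^sup>2) \<le> 1"
proof -
  \<comment> \<open>The row sum is the diagonal entry \<open>G $$ (i, i)\<close> of a Hermitian projection, hence at least its own square.\<close>
  define G where "G = Y * mat_adjoint Y"
  let ?t = "\<Sum>j<r. (cmod (Y $$ (i, j)))\<^sup>2"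
  have G: "G \<in> carrier_mat n n" unfolding G_def using Y by auto
  have Gh: "mat_adjoint G = G"
    unfolding G_def using Y by (simp add: mat_adjoint_mult[of _ n r _ n])
  have "G * G = Y * (mat_adjoint Y * Y) * mat_adjoint Y"
    unfolding G_def using Y by (simp add: mat_mult_assoc)
  then have GG: "G * G = G" using Y unfolding YY by (simp add: G_def)
  have t: "G $$ (i, i) = complex_of_real ?t"
    unfolding G_def mat_mult_index[OF Y mat_adjoint_carrier[OF Y] i i] of_real_sum
    using Y i by (auto simp: complex_norm_square simp del: of_real_power intro!: sum.cong)
  have "complex_of_real ?t = (mat_adjoint G * G) $$ (i, i)" using GG Gh t by simp
  also have "\<dots> = (\<Sum>k<n. complex_of_real ((cmod (G $$ (k, i)))\<^sup>2))"
    unfolding mat_mult_index[OF mat_adjoint_carrier[OF G] G i i]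
    using G i by (auto simp: complex_norm_square mult.commute simp del: of_real_power intro!: sum.cong)
  finally have "?t = (\<Sum>k<n. (cmod (G $$ (k, i)))\<^sup>2)"
    unfolding of_real_sum[symmetric] of_real_eq_iff .
  also have "\<dots> \<ge> (cmod (G $$ (i, i)))\<^sup>2"
    using i by (intro member_le_sum) auto
  finally have "?t\<^sup>2 \<le> ?t" unfolding t norm_of_real by simp
  then have "?t * (?t - 1) \<le> 0" by (simp add: power2_eq_square algebra_simps)
  then show ?thesis
    using sum_nonneg[of "{..<r}" "\<lambda>j. (cmod (Y $$ (i, j)))\<^sup>2"]
    by (cases "?t = 0") (auto simp: mult_le_0_iff)
qed

text \<open>In an eigenbasis \<open>Q\<close> the trace becomes the sum of the eigenvalues weighted
  by the squared row norms of \<open>Y = mat_adjoint Q * W\<close>. Since \<open>Y\<close> again has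
  orthonormal columns, these weights lie in [0, 1] and add up to \<open>r\<close>, so the sum is at
  most that of the \<open>r\<close> largest eigenvalues.\<close>

lemma ky_fan_upper_bound:
  fixes X W :: "complex mat"
  assumes X: "X \<in> carrier_mat n n" and herm: "mat_adjoint X = X"
    and es: "sorted_eigenvalues X es" and r: "r \<le> length es"
    and W: "W \<in> carrier_mat n r" and WW: "mat_adjoint W * W = 1\<^sub>m r"
  shows "Re (mat_trace (mat_adjoint W * X * W)) \<le> sum_list (take r (rev es))"
proof -
  define f where "f = map complex_of_real es"
  have sorted: "sorted es" and cp: "char_poly X = (\<Prod>e\<leftarrow>f. [:- e, 1:])"
    using es by (auto simp: sorted_eigenvalues_def f_def comp_def)
  \<comment> \<open>Comparing degrees of the characteristic polynomial: the list accounts for every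
    eigenvalue with multiplicity.\<close>
  have n: "length es = n"
    using degree_monic_char_poly[OF X] degree_linear_factors[of uminus f]
    by (simp add: cp f_def)
  obtain Q where Q: "Q \<in> carrier_mat n n" and QQ: "mat_adjoint Q * Q = 1\<^sub>m n"
    and QXQ: "mat_adjoint Q * X * Q = mat n n (\<lambda>(i, j). if i = j then f ! i else 0)"
      (is "_ = ?D")
    using hermitian_diagonalization[OF X herm cp] by auto
  have QQ': "Q * mat_adjoint Q = 1\<^sub>m n"
    using mat_mult_left_right_inverse[OF _ Q QQ] Q by auto
  define Y where "Y = mat_adjoint Q * W"
  have Y: "Y \<in> carrier_mat n r" unfolding Y_def using Q W by auto
  have Yh: "mat_adjoint Y = mat_adjoint W * Q"
    unfolding Y_def using Q W by (simp add: mat_adjoint_mult[of _ n n _ r])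
  have QY: "Q * Y = W"
    unfolding Y_def using Q W QQ' by (simp flip: mat_mult_assoc)
  have YY: "mat_adjoint Y * Y = 1\<^sub>m r"
    unfolding Yh using Q W Y by (simp add: mat_mult_assoc QY WW)
  have YhQh: "mat_adjoint Y * mat_adjoint Q = mat_adjoint W"
    using mat_adjoint_mult[OF Q Y] by (simp add: QY)
  have "mat_adjoint W * X * W = mat_adjoint Y * ?D * Y"
    unfolding QXQ[symmetric] QY[symmetric] YhQh[symmetric] using Q X Y
    by (simp add: mat_adjoint_mult[of Q n n Y r] mat_mult_assoc)
  then have "mat_trace (mat_adjoint W * X * W) = mat_trace (mat_adjoint Y * (?D * Y))"
    using Y by (simp add: mat_mult_assoc)
  also have "\<dots> = (\<Sum>j<r. \<Sum>i<n. mat_adjoint Y $$ (j, i) * (?D * Y) $$ (i, j))"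
    unfolding mat_trace_def using Y
    by (auto simp del: index_mult_mat(1) mat_adjoint_index
        intro!: sum.cong mat_mult_index[of _ r n _ r])
  also have "\<dots> = (\<Sum>j<r. \<Sum>i<n. complex_of_real (es ! i * (cmod (Y $$ (i, j)))\<^sup>2))"
  proof (intro sum.cong refl)
    fix i j assume ij: "i \<in> {..<n}" "j \<in> {..<r}"
    have "(?D * Y) $$ (i, j) = (\<Sum>k<n. ?D $$ (i, k) * Y $$ (k, j))"
      using ij Y by (intro mat_mult_index[of _ n n _ r]) auto
    also have "\<dots> = (\<Sum>k<n. if k = i then f ! i * Y $$ (i, j) else 0)"
      using ij by (intro sum.cong) auto
    also have "\<dots> = f ! i * Y $$ (i, j)" using ij by simp
    finally show "mat_adjoint Y $$ (j, i) * (?D * Y) $$ (i, j)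
        = complex_of_real (es ! i * (cmod (Y $$ (i, j)))\<^sup>2)"
      using ij Y n by (simp add: f_def complex_norm_square del: of_real_power)
  qed
  also have "\<dots> = complex_of_real (\<Sum>i<n. es ! i * (\<Sum>j<r. (cmod (Y $$ (i, j)))\<^sup>2))"
    by (subst sum.swap) (simp add: sum_distrib_left)
  finally have "Re (mat_trace (mat_adjoint W * X * W))
      = (\<Sum>i<n. es ! i * (\<Sum>j<r. (cmod (Y $$ (i, j)))\<^sup>2))" by simp
  also have "\<dots> \<le> sum_list (take r (rev es))"
    unfolding n[symmetric]
  proof (rule sorted_weighted_sum_le_top[OF sorted r])
    fix i assume "i < length es"
    then show "0 \<le> (\<Sum>j<r. (cmod (Y $$ (i, j)))\<^sup>2) \<and> (\<Sum>j<r. (cmod (Y $$ (i, j)))\<^sup>2) \<le> 1"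
      using orthonormal_cols_row_sum_le_one[OF Y YY, of i] n by (auto intro: sum_nonneg)
  next
    \<comment> \<open>Summed by columns instead of rows, the weights give the trace of
      \<open>mat_adjoint Y * Y\<close>, an identity matrix of size \<open>r\<close>.\<close>
    have "complex_of_real (\<Sum>i<n. \<Sum>j<r. (cmod (Y $$ (i, j)))\<^sup>2)
        = (\<Sum>j<r. (mat_adjoint Y * Y) $$ (j, j))"
      unfolding of_real_sum using Y
      by (subst sum.swap) (auto simp: mat_mult_index[of _ r n _ r] complex_norm_square mult.commute
          simp del: index_mult_mat(1) of_real_power intro!: sum.cong)
    also have "\<dots> = complex_of_real (real r)" by (simp add: YY)
    finally show "(\<Sum>i<length es. \<Sum>j<r. (cmod (Y $$ (i, j)))\<^sup>2) = real r"
      unfolding of_real_eq_iff n .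
  qed
  finally show ?thesis .
qed

text \<open>The \<open>j\<close>-th diagonal entry is the eigenvalue of column \<open>j\<close>. The
  columns may come in any order \<open>es'\<close>, but the sum depends only on the
  multiset.\<close>

lemma orthonormal_eigenvectors_trace:
  assumes X: "X \<in> carrier_mat n n" and V: "orthonormal_eigenvectors X es V"
  shows "mat_trace (mat_adjoint V * X * V) = complex_of_real (sum_list es)"
proof -
  let ?r = "length es"
  obtain es' where mset: "mset es' = mset es"
    and ev: "\<And>j. j < ?r \<Longrightarrow> eigenvector X (col V j) (complex_of_real (es' ! j))"
    and VV: "mat_adjoint V * V = 1\<^sub>m ?r" and Vc: "V \<in> carrier_mat n ?r"
    using V X by (auto simp: orthonormal_eigenvectors_def)
  have len: "length es' = ?r" using mset by (metis size_mset)
  have "mat_adjoint V * X * V = mat_adjoint V * (X * V)"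
    using X Vc by (simp add: mat_mult_assoc)
  moreover have "(mat_adjoint V * (X * V)) $$ (j, j) = complex_of_real (es' ! j)"
    if j: "j < ?r" for j
  proof -
    have "(mat_adjoint V * (X * V)) $$ (j, j) = row (mat_adjoint V) j \<bullet> (X *\<^sub>v col V j)"
      using j Vc X by (intro mat_mult_index_vec[of _ ?r n _ n _ ?r]) auto
    also have "X *\<^sub>v col V j = complex_of_real (es' ! j) \<cdot>\<^sub>v col V j"
      using ev[OF j] by (simp add: eigenvector_def)
    also have "row (mat_adjoint V) j \<bullet> \<dots>
        = complex_of_real (es' ! j) * (row (mat_adjoint V) j \<bullet> col V j)"
      using Vc by (intro scalar_prod_smult_distrib[of _ n]) (auto intro!: carrier_vecI)
    also have "row (mat_adjoint V) j \<bullet> col V j = (mat_adjoint V * V) $$ (j, j)"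
      using Vc j by simp
    finally show ?thesis using j by (simp add: VV)
  qed
  ultimately have "mat_trace (mat_adjoint V * X * V) = (\<Sum>j<?r. complex_of_real (es' ! j))"
    unfolding mat_trace_def using Vc by (auto simp del: index_mult_mat(1))
  also have "\<dots> = complex_of_real (sum_list es')"
    by (simp add: sum_list_sum_nth len atLeast0LessThan)
  also have "sum_list es' = sum_list es" by (metis mset sum_mset_sum_list)
  finally show ?thesis .
qed

text \<open>The Ky Fan bound depends only on the eigenvalues, and every admissible choice of
  eigenvectors attains it, however ties are broken.\<close>

lemma zeta_max_maximizes_trace:
  assumes X: "X \<in> carrier_mat n n" and herm: "mat_adjoint X = X" and V: "zeta_max r X V"
    and W: "W \<in> carrier_mat n r" and WW: "mat_adjoint W * W = 1\<^sub>m r"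
  shows "Re (mat_trace (mat_adjoint W * X * W)) \<le> Re (mat_trace (mat_adjoint V * X * V))"
proof -
  obtain es where es: "sorted_eigenvalues X es" "r \<le> length es"
    and V: "orthonormal_eigenvectors X (take r (rev es)) V"
    using V by (auto simp: zeta_max_def)
  show ?thesis
    using ky_fan_upper_bound[OF X herm es W WW] orthonormal_eigenvectors_trace[OF X V] by simp
qed

section \<open>Orthonormality of the iterates\<close>

lemma zeta_max_orthonormal:
  assumes "zeta_max r X V"
  shows "V \<in> carrier_mat (dim_row X) r" "mat_adjoint V * V = 1\<^sub>m r"
  using assms by (auto simp: zeta_max_def orthonormal_eigenvectors_def min_absorb2)

lemma zeta_min_orthonormal:
  assumes "zeta_min r X V"
  shows "V \<in> carrier_mat (dim_row X) r" "mat_adjoint V * V = 1\<^sub>m r"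
  using assms by (auto simp: zeta_min_def orthonormal_eigenvectors_def min_absorb2)

text \<open>Covers the initial \<open>U\<close>, which does not come from a
  \<open>U\<close>-update.\<close>

lemma first_cols_one_orthonormal:
  assumes "r \<le> n"
  shows "first_cols r (1\<^sub>m n) \<in> carrier_mat n r"
    "mat_adjoint (first_cols r (1\<^sub>m n)) * first_cols r (1\<^sub>m n) = 1\<^sub>m r"
proof -
  show F: "first_cols r (1\<^sub>m n) \<in> carrier_mat n r" by (simp add: first_cols_def)
  show "mat_adjoint (first_cols r (1\<^sub>m n)) * first_cols r (1\<^sub>m n) = 1\<^sub>m r"
  proof (rule eq_matI)
    fix i j assume "i < dim_row (1\<^sub>m r :: complex mat)" "j < dim_col (1\<^sub>m r :: complex mat)"
    then have ij: "i < r" "j < r" by auto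
    have "(mat_adjoint (first_cols r (1\<^sub>m n)) * first_cols r (1\<^sub>m n)) $$ (i, j)
        = (\<Sum>k<n. cnj (1\<^sub>m n $$ (k, i)) * 1\<^sub>m n $$ (k, j))"
      using ij F by (subst mat_mult_index[of _ r n _ r]) (auto simp: first_cols_def)
    also have "\<dots> = (\<Sum>k<n. if k = i then (if i = j then 1 else 0) else 0)"
      using ij assms by (intro sum.cong) auto
    finally have "(mat_adjoint (first_cols r (1\<^sub>m n)) * first_cols r (1\<^sub>m n)) $$ (i, j)
        = (\<Sum>k<n. if k = i then (if i = j then 1 else 0) else 0)" .
    then show "(mat_adjoint (first_cols r (1\<^sub>m n)) * first_cols r (1\<^sub>m n)) $$ (i, j) = 1\<^sub>m r $$ (i, j)"
      using ij assms by simp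
  qed (use F in auto)
qed

text \<open>All \<open>d\<close> eigenvectors of a matrix of size \<open>d\<close> are taken, so
  \<open>V\<close> is square and its orthonormal columns make it unitary. The two factors
  \<open>sqrt (Pt / real d)\<close> multiply to the stated scalar.\<close>

lemma P_update_scaled_unitary:
  assumes d: "0 < d" and Pt: "0 \<le> Pt" and upd: "P_update K N d Pt H Delta U P"
    and l: "l \<in> {1..K}"
  shows "P l \<in> carrier_mat d d"
    "P l * mat_adjoint (P l) = complex_of_real (Pt / real d) \<cdot>\<^sub>m 1\<^sub>m d"
proof -
  define s where "s = sqrt (Pt / real d)"
  obtain A V where zeta: "zeta_min d (mat_sum d d A ({1..K} - {l})) V"
    and P: "P l = complex_of_real s \<cdot>\<^sub>m V"
    using upd l unfolding P_update_def s_def by blast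
  have V: "V \<in> carrier_mat d d" "mat_adjoint V * V = 1\<^sub>m d"
    using zeta_min_orthonormal[OF zeta] by auto
  have VV: "V * mat_adjoint V = 1\<^sub>m d"
    using mat_mult_left_right_inverse[OF _ V(1,2)] V(1) by auto
  show "P l \<in> carrier_mat d d" using V(1) P by simp
  have "mat_adjoint (P l) = complex_of_real s \<cdot>\<^sub>m mat_adjoint V"
    unfolding P by (rule eq_matI) auto
  then have "P l * mat_adjoint (P l) = complex_of_real s \<cdot>\<^sub>m (complex_of_real s \<cdot>\<^sub>m 1\<^sub>m d)"
    using V(1) unfolding P
    by (simp add: mult_smult_distrib[of _ d d _ d] mult_smult_assoc_mat[of V d d _ d] VV)
  also have "\<dots> = (complex_of_real s * complex_of_real s) \<cdot>\<^sub>m 1\<^sub>m d"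
    by (rule eq_matI) auto
  also have "complex_of_real s * complex_of_real s = complex_of_real (Pt / real d)"
    unfolding of_real_mult[symmetric] s_def using d Pt by simp
  finally show "P l * mat_adjoint (P l) = complex_of_real (Pt / real d) \<cdot>\<^sub>m 1\<^sub>m d" .
qed

section \<open>Effect of the two updates on the cost\<close>

context
  fixes K M N d :: nat
    and H :: "nat \<Rightarrow> nat \<Rightarrow> complex mat" and Delta :: "nat \<Rightarrow> complex mat"
  assumes H: "\<And>k l. k \<in> {1..K} \<Longrightarrow> l \<in> {1..K} \<Longrightarrow> H k l \<in> carrier_mat N M"
    and Delta: "\<And>l. l \<in> {1..K} \<Longrightarrow> Delta l \<in> carrier_mat M d"
begin

text \<open>\<open>P l\<close> factors out of each residual on the right and only rescales its norm.
  The resulting expression no longer mentions \<open>P\<close>, so precoders with the same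
  \<open>c\<close> have equal cost.\<close>

lemma leakage_cost_scaled_unitary:
  assumes U: "\<And>k. k \<in> {1..K} \<Longrightarrow> U k \<in> carrier_mat N r"
    and P: "\<And>l. l \<in> {1..K} \<Longrightarrow> P l \<in> carrier_mat d d"
    and PP: "\<And>l. l \<in> {1..K} \<Longrightarrow> P l * mat_adjoint (P l) = complex_of_real c \<cdot>\<^sub>m 1\<^sub>m d"
  shows "leakage_cost K H Delta P U = (\<Sum>k\<in>{1..K}. \<Sum>l\<in>{1..K} - {k}.
    c * (frobenius_norm (H k l * Delta l - U k * mat_adjoint (U k) * H k l * Delta l))\<^sup>2)"
  unfolding leakage_cost_def
proof (intro sum.cong refl)
  fix k l assume k: "k \<in> {1..K}" and l': "l \<in> {1..K} - {k}"
  then have l: "l \<in> {1..K}" by simp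
  note carriers = H[OF k l] Delta[OF l] U[OF k] P[OF l]
  let ?X = "H k l * Delta l - U k * mat_adjoint (U k) * H k l * Delta l"
  have X: "?X \<in> carrier_mat N d" using carriers by (auto intro!: carrier_matI)
  have "H k l * Delta l * P l - U k * mat_adjoint (U k) * H k l * Delta l * P l = ?X * P l"
    using carriers by (intro minus_mult_distrib_mat[symmetric, of _ N d _ _ d]) auto
  then show "(frobenius_norm (H k l * Delta l * P l - U k * mat_adjoint (U k) * H k l * Delta l * P l))\<^sup>2
      = c * (frobenius_norm ?X)\<^sup>2"
    using frobenius_norm_mult_scaled_unitary[OF X P[OF l] PP[OF l]] by simp
qed

text \<open>The outer summand for \<open>k\<close> involves \<open>U k\<close> and no other receiver
  matrix, so the sums can be compared receiver by receiver.\<close>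

lemma U_update_decreases_leakage_cost:
  assumes upd: "U_update K N d H Delta P U'"
    and U: "\<And>k. k \<in> {1..K} \<Longrightarrow> U k \<in> carrier_mat N (N - d)"
      "\<And>k. k \<in> {1..K} \<Longrightarrow> mat_adjoint (U k) * U k = 1\<^sub>m (N - d)"
    and P: "\<And>l. l \<in> {1..K} \<Longrightarrow> P l \<in> carrier_mat d d"
  shows "leakage_cost K H Delta P U' \<le> leakage_cost K H Delta P U"
  unfolding leakage_cost_def
proof (rule sum_mono)
  fix k assume k: "k \<in> {1..K}"
  define A where "A l = H k l * Delta l * P l" for l
  define I where "I = {1..K} - {k}"
  define X where "X = mat_sum N N (\<lambda>l. A l * mat_adjoint (A l)) I"
  have A: "A l \<in> carrier_mat N d" if "l \<in> I" for l
    unfolding A_def using H[OF k] Delta P that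
    by (intro mult_carrier_mat[of _ N d] mult_carrier_mat[of _ N M]) (auto simp: I_def)
  have AA: "A l * mat_adjoint (A l) \<in> carrier_mat N N" if "l \<in> I" for l
    using A[OF that] by auto
  \<comment> \<open>Regrouping the factors of the update as \<open>A l * mat_adjoint (A l)\<close>
    makes the matrix visibly Hermitian and matches the trace in the residual formula.\<close>
  have AA_eq: "H k l * Delta l * P l * mat_adjoint (P l) * mat_adjoint (Delta l) * mat_adjoint (H k l)
      = A l * mat_adjoint (A l)" if "l \<in> I" for l
    using H[OF k, of l] Delta[of l] P[of l] that unfolding A_def I_def
    by (simp add: mat_adjoint_mult[of _ N d _ d] mat_adjoint_mult[of _ N M _ d]
        mat_adjoint_mult[of _ M d _ d]
        mult_carrier_mat[of _ N M _ d] mat_mult_assoc)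
  have upd': "zeta_max (N - d) X (U' k)"
  proof -
    have "mat_sum N N (\<lambda>l. H k l * Delta l * P l * mat_adjoint (P l) * mat_adjoint (Delta l)
        * mat_adjoint (H k l)) I = X"
      unfolding X_def by (rule mat_sum_cong) (rule AA_eq)
    then show ?thesis
      using bspec[OF upd[unfolded U_update_def] k] by (simp only: I_def)
  qed
  have X: "X \<in> carrier_mat N N" by (simp add: X_def)
  have herm: "mat_adjoint X = X"
    unfolding X_def using A
    by (intro mat_adjoint_sum_self AA) (auto simp: mat_adjoint_mult[of _ N d _ N])
  have U': "U' k \<in> carrier_mat N (N - d)" "mat_adjoint (U' k) * U' k = 1\<^sub>m (N - d)"
    using zeta_max_orthonormal[OF upd'] X by auto
  \<comment> \<open>Stated for every \<open>W\<close> with orthonormal columns, since it is applied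
    to both the new and the old receiver matrix; the first sum is common to both.\<close>
  have cost: "(\<Sum>l\<in>I. (frobenius_norm (A l - W * mat_adjoint W * H k l * Delta l * P l))\<^sup>2)
      = (\<Sum>l\<in>I. (frobenius_norm (A l))\<^sup>2) - Re (mat_trace (mat_adjoint W * X * W))"
    if W: "W \<in> carrier_mat N (N - d)" "mat_adjoint W * W = 1\<^sub>m (N - d)" for W
  proof -
    have "W * mat_adjoint W * H k l * Delta l * P l = W * mat_adjoint W * A l" if "l \<in> I" for l
      using H[OF k, of l] Delta[of l] P[of l] that W(1) unfolding A_def I_def
      by (simp add: mat_mult_assoc)
    moreover have "mat_trace (mat_adjoint W * X * W)
        = (\<Sum>l\<in>I. mat_trace (mat_adjoint W * (A l * mat_adjoint (A l)) * W))"
      unfolding X_def using AA W(1) by (intro mat_trace_conj_sum) (auto simp: I_def)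
    ultimately show ?thesis
      using W by (simp add: orthonormal_residual_frobenius[OF A] sum_subtractf)
  qed
  show "(\<Sum>l\<in>{1..K} - {k}. (frobenius_norm (H k l * Delta l * P l
          - U' k * mat_adjoint (U' k) * H k l * Delta l * P l))\<^sup>2)
      \<le> (\<Sum>l\<in>{1..K} - {k}. (frobenius_norm (H k l * Delta l * P l
          - U k * mat_adjoint (U k) * H k l * Delta l * P l))\<^sup>2)"
    unfolding A_def[symmetric] I_def[symmetric]
    using cost[OF U'] cost[OF U(1,2)[OF k]] zeta_max_maximizes_trace[OF X herm upd' U(1,2)[OF k]]
    by simp
qed

end

theorem theorem3:
  fixes K M N Ne d :: nat
    and Pt :: real
    and H :: "nat \<Rightarrow> nat \<Rightarrow> complex mat"
    and Phi S Xi Delta :: "nat \<Rightarrow> complex mat"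
    and P U :: "nat \<Rightarrow> nat \<Rightarrow> complex mat"
  assumes "K > 0" "M > 0" "N > 0" "Ne > 0" "d > 0"
    and "d \<le> N" and "Ne + d \<le> M" and "Pt > 0"
    and "\<And>k l. k \<in> {1..K} \<Longrightarrow> l \<in> {1..K} \<Longrightarrow> H k l \<in> carrier_mat N M"
    and "\<And>l. l \<in> {1..K} \<Longrightarrow> H (K + 1) l \<in> carrier_mat Ne M"
    and "\<And>l. l \<in> {1..K} \<Longrightarrow> is_svd (H (K + 1) l) (Phi l) (S l) (Xi l)"
    and "\<And>l. l \<in> {1..K} \<Longrightarrow> Delta l = last_cols d (Xi l)"
    and "zfws_iterates K N d Pt H Delta P U"
  shows "(\<forall>\<kappa>. leakage_cost K H Delta (P (\<kappa> + 1)) (U (\<kappa> + 1))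
              \<le> leakage_cost K H Delta (P \<kappa>) (U \<kappa>)) \<and>
         convergent (\<lambda>\<kappa>. leakage_cost K H Delta (P \<kappa>) (U \<kappa>))"
proof -
  note H = assms(9) and d = \<open>d > 0\<close>
  have Pt: "0 \<le> Pt" using \<open>Pt > 0\<close> by simp
  \<comment> \<open>The decomposition makes \<open>Xi l\<close> a square matrix of size
    \<open>M\<close>, which fixes the number of rows of its last columns.\<close>
  have Delta: "Delta l \<in> carrier_mat M d" if "l \<in> {1..K}" for l
    using assms(10-12)[OF that] by (auto simp: is_svd_def unitary_mat_def last_cols_def)
  have U0: "U 0 k = first_cols (N - d) (1\<^sub>m N)" if "k \<in> {1..K}" for k
    using assms(13) that by (simp add: zfws_iterates_def)
  have Uupd: "U_update K N d H Delta (P \<kappa>) (U (\<kappa> + 1))" for \<kappa>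
    using assms(13) by (simp add: zfws_iterates_def)
  \<comment> \<open>Initialization and iteration both compute \<open>P\<close> from the
    \<open>U\<close> of the same index, so one statement covers all \<kappa>.\<close>
  have Pupd: "P_update K N d Pt H Delta (U \<kappa>) (P \<kappa>)" for \<kappa>
    using assms(13) by (cases \<kappa>) (simp_all add: zfws_iterates_def)
  note P = P_update_scaled_unitary[OF d Pt Pupd]
  have U: "U \<kappa> k \<in> carrier_mat N (N - d) \<and> mat_adjoint (U \<kappa> k) * U \<kappa> k = 1\<^sub>m (N - d)"
    if "k \<in> {1..K}" for \<kappa> k
  proof (cases \<kappa>)
    case 0
    then show ?thesis using U0[OF that] first_cols_one_orthonormal[of "N - d" N] by simp
  next
    case (Suc m)
    then show ?thesis
      using Uupd[of m] that zeta_max_orthonormal unfolding U_update_def by fastforce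
  qed
  let ?J = "\<lambda>\<kappa>. leakage_cost K H Delta (P \<kappa>) (U \<kappa>)"
  have decr: "?J (\<kappa> + 1) \<le> ?J \<kappa>" for \<kappa>
  proof -
    \<comment> \<open>The right-hand side is free of \<open>i\<close>: with
      \<open>U (\<kappa> + 1)\<close> fixed, \<open>P (\<kappa> + 1)\<close> can be exchanged for
      \<open>P \<kappa>\<close>. This reduces the comparison to the \<open>U\<close>-update.\<close>
    have "leakage_cost K H Delta (P i) (U (\<kappa> + 1)) = (\<Sum>k\<in>{1..K}. \<Sum>l\<in>{1..K} - {k}. Pt / real d *
        (frobenius_norm (H k l * Delta l
          - U (\<kappa> + 1) k * mat_adjoint (U (\<kappa> + 1) k) * H k l * Delta l))\<^sup>2)" for i
      using U by (intro leakage_cost_scaled_unitary[OF H Delta _ P]) auto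
    then have "?J (\<kappa> + 1) = leakage_cost K H Delta (P \<kappa>) (U (\<kappa> + 1))" by (simp only:)
    also have "\<dots> \<le> ?J \<kappa>"
      using U_update_decreases_leakage_cost[OF H Delta Uupd, where U = "U \<kappa>"] U P by simp
    finally show ?thesis .
  qed
  moreover have "convergent ?J"
  proof -
    \<comment> \<open>A decreasing sequence bounded below, here by 0 as a sum of squares,
      converges.\<close>
    have "decseq ?J" using decr by (intro decseq_SucI) simp
    moreover have "0 \<le> ?J \<kappa>" for \<kappa>
      unfolding leakage_cost_def by (intro sum_nonneg) auto
    ultimately show ?thesis
      using decseq_convergent[of ?J 0] convergentI[of ?J] by metis
  qed
  ultimately show ?thesis by blast
qed

end
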